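(* For all parameters $a,b,a',b'$ and generic $c$, as an identity of formal double power series in $x,y$, $$\sum_{\mu,\nu\ge0}\frac{(a)_\mu(b)_\mu(a')_\nu(b')_\nu}{(c)_{\mu+\nu}\,\mu!\,\nu!}x^\mu y^\nu=\sum_{r\ge0}\frac{(-1)^r(a)_r(b)_r(a')_r(b')_r}{r!\,(c)_{2r}\,(c+r-1)_r}\,(xy)^r\;{}_2F_1(a+r,b+r;c+2r;x)\;{}_2F_1(a'+r,b'+r;c+2r;y).$$
   Context: $(z)_k=z(z+1)\cdots(z+k-1)$ is the Pochhammer symbol and ${}_2F_1(a,b;c;x)=\sum_{k\ge0}\frac{(a)_k(b)_k}{(c)_kk!}x^k$ is regarded as a formal power series. "Generic $c$" means that $c$ is such that no denominator vanishes (e.g. $c$ an indeterminate, or $c\in\mathbb C\setminus\{0,-1,-2,\dots\}$). *)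

theory Defs
  imports "HOL-Computational_Algebra.Computational_Algebra"
begin

text \<open>
  A formal double power series in \<open>x, y\<close> is an element of \<open>'a fps fps\<close>: the outer variable is \<open>x\<close>
  and the inner one is \<open>y\<close>, so the coefficient of \<open>x^\<mu> y^\<nu>\<close> in \<open>F\<close> is \<open>F $ \<mu> $ \<nu>\<close>.
  The convergence implicit in \<open>sums\<close> on this type is the topology of the library, i.e. the
  \<open>x\<close>-adic one. It is finer than the \<open>(x, y)\<close>-adic and the coefficientwise topologies, so
  convergence in it implies convergence in those, to the same limit.
\<close>

definition fps2_of_coeffs :: "(nat \<Rightarrow> nat \<Rightarrow> 'a) \<Rightarrow> 'a fps fps"
  where "fps2_of_coeffs f = Abs_fps (\<lambda>\<mu>. Abs_fps (\<lambda>\<nu>. f \<mu> \<nu>))"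

definition fps2_scalar :: "'a::zero \<Rightarrow> 'a fps fps"
  where "fps2_scalar k = fps_const (fps_const k)"

definition fps2_x :: "'a::comm_ring_1 fps fps"
  where "fps2_x = fps_X"

definition fps2_y :: "'a::comm_ring_1 fps fps"
  where "fps2_y = fps_const fps_X"

text \<open>The substitutions \<open>f \<mapsto> f(x)\<close> and \<open>f \<mapsto> f(y)\<close> of a series in one variable.\<close>

definition fps2_in_x :: "'a::zero fps \<Rightarrow> 'a fps fps"
  where "fps2_in_x f = Abs_fps (\<lambda>\<mu>. fps_const (f $ \<mu>))"

definition fps2_in_y :: "'a::zero fps \<Rightarrow> 'a fps fps"
  where "fps2_in_y f = fps_const f"

text \<open>
  The last argument of the library's \<open>fps_hypergeo\<close> is a factor by which the variable is scaled.
\<close>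

definition hyp2F1 :: "'a \<Rightarrow> 'a \<Rightarrow> 'a \<Rightarrow> 'a::field_char_0 fps"
  where "hyp2F1 a b c = fps_hypergeo [a, b] [c] 1"

lemma hyp2F1_nth:
  "hyp2F1 a b c $ k = pochhammer a k * pochhammer b k / (pochhammer c k * fact k)"
  by (simp add: hyp2F1_def)

end

theory Submission
  imports Defs
begin

text \<open>
  Write \<open>(z)\<^sub>k\<close> for \<^term>\<open>pochhammer z k\<close>. The \<open>m\<close>-th coefficient of the first hypergeometric
  series depends on \<open>a\<close> and \<open>b\<close> only through \<open>(a)\<^sub>m (b)\<^sub>m\<close>, and shifting the series by \<open>r\<close> and multiplying
  it by \<open>(a)\<^sub>r (b)\<^sub>r\<close> preserves this factor, because \<open>(a)\<^sub>r (a + r)\<^sub>m\<^sub>-\<^sub>r = (a)\<^sub>m\<close>; the same holds for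
  \<open>a'\<close> and \<open>b'\<close>. So the coefficient of \<open>x\<^sup>m y\<^sup>n\<close> has the factor \<open>(a)\<^sub>m (b)\<^sub>m (a')\<^sub>n (b')\<^sub>n\<close> on both sides,
  and what is left is an identity in \<open>c\<close>, \<open>m\<close> and \<open>n\<close> alone. Writing each \<open>1 / (m - r)!\<close> as
  \<open>(-1)\<^sup>r (-m)\<^sub>r / m!\<close> (\<open>shifted_hyp2F1_nth\<close>) turns it into
  \[ \sum_{r \le m} (-1)^r \frac{(c)_{2r}}{r!(c+r-1)_r} \frac{(-m)_r (-n)_r}{(c+m)_r (c+n)_r}
     = \frac{(c)_m}{(c+n)_m}. \]
  With \<open>c = 1 + d\<close> and \<open>d \<noteq> 0\<close> the first fraction is \<open>(d)\<^sub>r (1 + d/2)\<^sub>r / (r! (d/2)\<^sub>r)\<close>, so this is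
  the terminating very-well-poised \<open>\<^sub>4F\<^sub>3\<close> sum at \<open>-1\<close>. It remains true when \<open>-n\<close> becomes any \<open>x\<close> for
  which no denominator vanishes (\<open>well_poised_sum\<close>). By induction on \<open>m\<close> it amounts to a
  first-order recurrence for the left-hand side, and that recurrence follows by creative
  telescoping: the relevant combination of the summands for \<open>m\<close> and \<open>m + 1\<close> has hypergeometric
  partial sums (\<open>well_poised_partial_sum\<close>), and these contain the factor \<open>(-m)\<^sub>k\<close>, which is \<open>0\<close>
  for \<open>k > m\<close>.

  Convergence is immediate, since the \<open>r\<close>-th term of the series is divisible by \<open>x\<^sup>r\<close>.
\<close>

section \<open>A terminating very-well-poised sum\<close>

definition well_poised_term :: "'a::field_char_0 \<Rightarrow> 'a \<Rightarrow> nat \<Rightarrow> nat \<Rightarrow> 'a" where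
  "well_poised_term c x n r =
    (-1) ^ r * (pochhammer c (2 * r) / (fact r * pochhammer (c + of_nat r - 1) r))
      * pochhammer x r * pochhammer (- of_nat n) r
      / (pochhammer (c - x) r * pochhammer (c + of_nat n) r)"

text \<open>
  For \<open>r > 0\<close> the factors of \<open>(c)\<^sub>2\<^sub>r\<close> with indices from \<open>r - 1\<close> to \<open>2 r - 2\<close> are the denominator
  \<open>(c + r - 1)\<^sub>r\<close>. The case \<open>r = 0\<close> has to stay apart: there the cancelled form would read
  \<open>(c - 1) (c)\<^sub>-\<^sub>1\<close>, which has no meaning for \<open>c = 1\<close>.
\<close>

lemma well_poised_weight_Suc:
  fixes c :: "'a::field_char_0"
  assumes generic: "\<And>n::nat. c \<noteq> - of_nat n"
  shows "pochhammer c (2 * Suc k) / (fact (Suc k) * pochhammer (c + of_nat (Suc k) - 1) (Suc k))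
    = (c + 2 * of_nat k + 1) * pochhammer c k / fact (Suc k)"
proof -
  have "c + of_nat k + of_nat i \<noteq> 0" for i
    using generic[of "k + i"] unfolding eq_neg_iff_add_eq_0 by (simp add: add.assoc)
  then have nz: "pochhammer (c + of_nat k) (Suc k) \<noteq> 0"
    by (auto simp: pochhammer_eq_0_iff eq_neg_iff_add_eq_0)
  have "pochhammer c (2 * Suc k) = pochhammer c (Suc (k + Suc k))"
    by (simp add: mult_2)
  also have "\<dots> = pochhammer c (k + Suc k) * (c + of_nat (k + Suc k))"
    by (rule pochhammer_Suc)
  also have "\<dots> = pochhammer c k * pochhammer (c + of_nat k) (Suc k) * (c + 2 * of_nat k + 1)"
    unfolding pochhammer_product'[of c k "Suc k"] by (simp add: algebra_simps)
  finally show ?thesis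
    using nz by (simp add: divide_simps del: pochhammer_Suc fact_Suc)
qed

text \<open>
  The right-hand side comes from Zeilberger's method. Put \<open>d = c - 1\<close>, \<open>N = n + 1\<close>, \<open>m = -x\<close>. The \<open>r\<close>-th
  summand is \<open>N m + r (d + r)\<close> times \<^term>\<open>well_poised_term c x (Suc n) r\<close>\<open> / N\<close>, and
  \[ (d + 2r) (N m + r (d + r)) = (d + r) (N - r) (m - r) + r (d + N + r) (d + m + r). \]
  After division by \<open>d + 2 r\<close> the two products on the right belong to \<open>G (r + 1)\<close> and to \<open>- G r\<close>
  for one function \<open>G\<close> with \<open>G 0 = 0\<close>, so that the sum telescopes to \<open>G (k + 1)\<close>. There \<open>d + 2 r\<close>
  cancels against the weight, which is why the closed form makes sense for \<open>d = 0\<close> too.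
\<close>

lemma well_poised_partial_sum:
  fixes c x :: "'a::field_char_0"
  assumes generic: "\<And>n::nat. c \<noteq> - of_nat n" "\<And>n::nat. c - x \<noteq> - of_nat n"
  shows "(\<Sum>r\<le>k. (c - x + of_nat n) * well_poised_term c x (Suc n) r
                - (c + of_nat n) * well_poised_term c x n r)
    = (-1) ^ Suc k * pochhammer c k * pochhammer (- of_nat n) k * pochhammer x (Suc k)
        / (fact k * pochhammer (c - x) k * pochhammer (c + of_nat (Suc n)) k)"
proof (induction k)
  case 0
  show ?case by (simp add: well_poised_term_def)
next
  case (Suc k)
  define e where "e = c - x"
  define N :: 'a where "N = of_nat n"
  define K :: 'a where "K = of_nat k"
  define C where "C = pochhammer c k"
  define P where "P = pochhammer (- N) k"
  define Q where "Q = pochhammer x (Suc k)"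
  define E where "E = pochhammer e k"
  define D where "D = pochhammer (c + N + 1) k"
  define F where "F = (fact k :: 'a)"
  have nz': "c + of_nat i \<noteq> 0" "e + of_nat i \<noteq> 0" for i
    using generic(1)[of i] generic(2)[of i] by (simp_all add: eq_neg_iff_add_eq_0 e_def)
  have nz: "E \<noteq> 0" "D \<noteq> 0" "F \<noteq> 0" "1 + K \<noteq> 0" "c + N \<noteq> 0" "e + K \<noteq> 0" "c + N + 1 + K \<noteq> 0"
    using nz'(2) nz'(1)[of n] nz'(1)[of "n + 1 + i" for i] nz'(1)[of "n + 1 + k"]
      of_nat_neq_0[of k, where ?'a = 'a]
    by (auto simp: E_def D_def F_def N_def K_def pochhammer_eq_0_iff eq_neg_iff_add_eq_0 ac_simps
          simp del: of_nat_neq_0)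
  have w: "pochhammer c (2 * Suc k) / (fact (Suc k) * pochhammer (c + of_nat (Suc k) - 1) (Suc k))
      = (c + 2 * K + 1) * C / ((1 + K) * F)"
    unfolding well_poised_weight_Suc[OF generic(1)] by (simp add: K_def C_def F_def)
  have pN: "pochhammer (- of_nat n) (Suc k) = P * (K - N)"
    and pN1: "pochhammer (- of_nat (Suc n)) (Suc k) = - (N + 1) * P"
    and pE: "pochhammer (c - x) (Suc k) = E * (e + K)"
    and pD1: "pochhammer (c + of_nat (Suc n)) (Suc k) = D * (c + N + 1 + K)"
    and pD: "pochhammer (c + of_nat n) (Suc k) = (c + N) * D"
    and pQ: "pochhammer x (Suc (Suc k)) = Q * (x + K + 1)"
    and pC: "pochhammer c (Suc k) = C * (c + K)"
    and pP: "pochhammer (- of_nat n) k = P"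
    and pd: "pochhammer (c + of_nat (Suc n)) k = D"
    and pc: "pochhammer c k = C" "pochhammer (c - x) k = E"
    by (simp_all add: pochhammer_Suc[of "- of_nat n"] pochhammer_rec[of "- 1 - of_nat n"]
        pochhammer_Suc[of e] pochhammer_Suc[of x "Suc k"] pochhammer_Suc[of c k]
        pochhammer_Suc[of "1 + (c + of_nat n)"] pochhammer_rec[of "c + of_nat n"] e_def[symmetric]
        P_def Q_def C_def E_def D_def N_def K_def algebra_simps)
  have F: "fact (Suc k) = (1 + K) * F"
    by (simp add: F_def K_def)
  \<comment> \<open>After division by the common factors this is an identity of polynomials; \<open>s\<close> is \<open>(-1)\<^sup>k\<close>.\<close>
  have field_step: "(- s) * C * P * Q / (F * E * D)
      + ((e + N) * ((- s * ((c + 2 * K + 1) * C / ((1 + K) * F))) * Q * (- (N + 1) * P)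
          / (E * (e + K) * (D * (c + N + 1 + K))))
      - (c + N) * ((- s * ((c + 2 * K + 1) * C / ((1 + K) * F))) * Q * (P * (K - N))
          / (E * (e + K) * ((c + N) * D))))
    = s * (C * (c + K)) * (P * (K - N)) * (Q * (c - e + K + 1))
        / ((1 + K) * F * (E * (e + K)) * (D * (c + N + 1 + K)))"
    for s
    using nz by (simp add: divide_simps) algebra
  show ?case
    unfolding sum.atMost_Suc Suc.IH
    unfolding well_poised_term_def w pN pN1 pE pD1 pD pQ pC pP pd pc
    unfolding F Q_def[symmetric] N_def[symmetric] F_def[symmetric] e_def[symmetric]
    using field_step[of "(-1) ^ k"]
    by (simp add: e_def power_Suc)
qed

lemma well_poised_sum:
  fixes c x :: "'a::field_char_0"
  assumes generic: "\<And>n::nat. c \<noteq> - of_nat n" "\<And>n::nat. c - x \<noteq> - of_nat n"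
  shows "(\<Sum>r\<le>n. well_poised_term c x n r) = pochhammer c n / pochhammer (c - x) n"
proof (induction n)
  case 0
  show ?case by (simp add: well_poised_term_def)
next
  case (Suc n)
  let ?V = "well_poised_term c x"
  have van: "pochhammer (- of_nat n :: 'a) (Suc n) = 0"
    by (simp add: pochhammer_of_nat_eq_0_lemma)
  have "(c - x + of_nat n) * (\<Sum>r\<le>Suc n. ?V (Suc n) r) - (c + of_nat n) * (\<Sum>r\<le>Suc n. ?V n r)
      = (\<Sum>r\<le>Suc n. (c - x + of_nat n) * ?V (Suc n) r - (c + of_nat n) * ?V n r)"
    by (simp only: sum_distrib_left sum_subtractf)
  also have "\<dots> = 0"
    unfolding well_poised_partial_sum[OF generic] van by simp
  finally have "(c - x + of_nat n) * (\<Sum>r\<le>Suc n. ?V (Suc n) r)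
      = (c + of_nat n) * (\<Sum>r\<le>Suc n. ?V n r)"
    by simp
  also have "(\<Sum>r\<le>Suc n. ?V n r) = (\<Sum>r\<le>n. ?V n r)"
    by (simp add: well_poised_term_def van del: of_nat_Suc)
  also have "\<dots> = pochhammer c n / pochhammer (c - x) n"
    by (rule Suc.IH)
  finally show "(\<Sum>r\<le>Suc n. ?V (Suc n) r) = pochhammer c (Suc n) / pochhammer (c - x) (Suc n)"
    using generic(2)[of n] unfolding eq_neg_iff_add_eq_0
    by (simp add: pochhammer_Suc nonzero_eq_divide_eq mult.commute del: sum.atMost_Suc
        flip: divide_divide_eq_left)
qed

section \<open>Coefficients of the series\<close>

lemma inverse_fact_diff_eq_pochhammer:
  assumes "r \<le> m"
  shows "1 / fact (m - r) = (-1) ^ r * pochhammer (- of_nat m) r / (fact m :: 'a::field_char_0)"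
proof -
  have "(-1) ^ r * pochhammer (- of_nat m) r / fact r = (of_nat m gchoose r :: 'a)"
    by (simp add: gbinomial_pochhammer)
  also have "\<dots> = fact m / (fact r * fact (m - r))"
    using assms by (simp add: binomial_gbinomial[symmetric] binomial_fact)
  finally show ?thesis by (simp add: field_simps)
qed

text \<open>
  This separates the parameters: the first factor on the right-hand side does not depend on \<open>r\<close>,
  and the second one does not depend on \<open>a\<close> and \<open>b\<close>. The product \<open>(-m)\<^sub>r\<close>, which is \<open>0\<close> for \<open>r > m\<close>,
  encodes that the shifted series has no coefficients below \<open>r\<close>.
\<close>

lemma shifted_hyp2F1_nth:
  fixes a b c :: "'a::field_char_0"
  assumes generic: "\<And>n::nat. c \<noteq> - of_nat n"
  shows "pochhammer a r * pochhammer b r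
      * (fps_X ^ r * hyp2F1 (a + of_nat r) (b + of_nat r) (c + 2 * of_nat r)) $ m
    = pochhammer a m * pochhammer b m / (pochhammer c m * fact m)
      * (pochhammer c (2 * r) * (-1) ^ r * pochhammer (- of_nat m) r / pochhammer (c + of_nat m) r)"
proof (cases "r \<le> m")
  case False
  then show ?thesis by (simp add: fps_X_power_mult_nth pochhammer_of_nat_eq_0_lemma)
next
  case True
  have ab: "pochhammer z r * pochhammer (z + of_nat r) (m - r) = pochhammer z m" for z :: 'a
    by (rule pochhammer_product[OF True, symmetric])
  have nz: "pochhammer c k \<noteq> 0" for k
    using generic by (auto simp: pochhammer_eq_0_iff)
  have "pochhammer c (2 * r) * pochhammer (c + 2 * of_nat r) (m - r) = pochhammer c (m + r)"
  proof -
    have "2 * r + (m - r) = m + r" using True by simp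
    then show ?thesis using pochhammer_product'[of c "2 * r" "m - r"]
      by (simp only: of_nat_mult of_nat_numeral)
  qed
  also have "\<dots> = pochhammer c m * pochhammer (c + of_nat m) r"
    by (rule pochhammer_product')
  finally have den: "pochhammer (c + 2 * of_nat r) (m - r)
      = pochhammer c m * pochhammer (c + of_nat m) r / pochhammer c (2 * r)"
    using nz[of "2 * r"] by (metis nonzero_mult_div_cancel_left)
  have split: "p * q * (p' * q' / (C * D / E * f)) = p * p' * (q * q') / (C * D) * E * (1 / f)"
    for p q p' q' C D E f :: 'a
    by simp
  have merge: "u / (C * D) * E * (s * X / f) = u / (C * f) * (E * s * X / D)"
    for u C D E s X f :: 'a
    by (simp add: ac_simps)
  show ?thesis
    by (simp only: fps_X_power_mult_nth not_less[THEN iffD2, OF True] if_False hyp2F1_nth den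
        split ab inverse_fact_diff_eq_pochhammer[OF True] merge)
qed

lemma fps2_separated_nth:
  fixes k :: "'a::comm_ring_1"
  shows "(fps2_scalar k * (fps2_x * fps2_y) ^ r * fps2_in_x f * fps2_in_y g) $ m $ n
    = k * (fps_X ^ r * f) $ m * (fps_X ^ r * g) $ n"
proof -
  have "fps2_scalar k * (fps2_x * fps2_y) ^ r * fps2_in_x f * fps2_in_y g
      = fps_const (fps_const k * (fps_X ^ r * g)) * (fps_X ^ r * fps2_in_x f)"
    by (simp add: fps2_scalar_def fps2_x_def fps2_y_def fps2_in_y_def power_mult_distrib
        fps_const_mult[symmetric] fps_const_power[symmetric] ac_simps
        del: fps_const_mult fps_const_power)
  moreover have "(fps_X ^ r * fps2_in_x f) $ m = fps_const ((fps_X ^ r * f) $ m)"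
    by (simp add: fps_X_power_mult_nth fps2_in_x_def)
  ultimately have "(fps2_scalar k * (fps2_x * fps2_y) ^ r * fps2_in_x f * fps2_in_y g) $ m
      = fps_const k * (fps_X ^ r * g) * fps_const ((fps_X ^ r * f) $ m)"
    by simp
  then show ?thesis by (simp add: mult.assoc mult.left_commute[of k] mult.commute)
qed

section \<open>The expansion\<close>

theorem theorem8p1:
  fixes a b a' b' c :: "'a::field_char_0"
  assumes generic: "\<And>n::nat. c \<noteq> - of_nat n"
  shows
    "(\<lambda>r::nat.
        fps2_scalar
          ((-1) ^ r * pochhammer a r * pochhammer b r * pochhammer a' r * pochhammer b' r
            / (fact r * pochhammer c (2 * r) * pochhammer (c + of_nat r - 1) r))
        * (fps2_x * fps2_y) ^ r
        * fps2_in_x (hyp2F1 (a + of_nat r) (b + of_nat r) (c + 2 * of_nat r))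
        * fps2_in_y (hyp2F1 (a' + of_nat r) (b' + of_nat r) (c + 2 * of_nat r)))
     sums
       fps2_of_coeffs (\<lambda>\<mu> \<nu>.
         pochhammer a \<mu> * pochhammer b \<mu> * pochhammer a' \<nu> * pochhammer b' \<nu>
           / (pochhammer c (\<mu> + \<nu>) * fact \<mu> * fact \<nu>))"
    (is "?T sums ?F")
proof -
  have nz: "pochhammer c k \<noteq> 0" for k
    using generic by (auto simp: pochhammer_eq_0_iff)
  define A where "A = (\<lambda>m n. pochhammer a m * pochhammer b m / (pochhammer c m * fact m)
    * (pochhammer a' n * pochhammer b' n / (pochhammer c n * fact n)))"
  define V where "V = (\<lambda>m n. well_poised_term c (- of_nat n) m)"
  have term_nth: "?T r $ m $ n = A m n * V m n r" for r m n
  proof -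
    let ?w = "(-1) ^ r / (fact r * pochhammer c (2 * r) * pochhammer (c + of_nat r - 1) r)"
    have "?T r $ m $ n = ?w
        * (pochhammer a r * pochhammer b r
            * (fps_X ^ r * hyp2F1 (a + of_nat r) (b + of_nat r) (c + 2 * of_nat r)) $ m)
        * (pochhammer a' r * pochhammer b' r
            * (fps_X ^ r * hyp2F1 (a' + of_nat r) (b' + of_nat r) (c + 2 * of_nat r)) $ n)"
      unfolding fps2_separated_nth by simp
    also have "\<dots> = A m n * V m n r"
    proof -
      \<comment> \<open>Each of the two shifted series contributes a sign \<open>(-1)\<^sup>r\<close> and a factor \<open>(c)\<^sub>2\<^sub>r\<close>.\<close>
      have cancel: "s / (F * C * P) * (M * (C * s * X / Y)) * (M' * (C * s * X' / Y'))
          = M * M' * (s * (C / (F * P)) * X' * X / (Y' * Y))"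
        if "s * s = 1" "C \<noteq> 0" for s F C P M X Y M' X' Y' :: 'a
      proof -
        have "s / (F * C * P) * (M * (C * s * X / Y)) * (M' * (C * s * X' / Y'))
            = (s * s) * (M * M' * (s * ((C * C) / (F * C * P)) * X' * X / (Y' * Y)))"
          by (simp only: times_divide_eq_left times_divide_eq_right divide_divide_eq_left
              divide_divide_eq_right ac_simps)
        also have "(C * C) / (F * C * P) = C / (F * P)"
          using that(2) by simp
        finally show ?thesis using that(1) by simp
      qed
      show ?thesis
        unfolding shifted_hyp2F1_nth[OF generic] A_def V_def well_poised_term_def diff_minus_eq_add
        by (rule cancel) (use nz in \<open>simp_all flip: power_mult_distrib\<close>)
    qed
    finally show ?thesis .
  qed
  have sum_nth: "(\<Sum>r<K. ?T r) $ m = ?F $ m" if "m < K" for m K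
  proof (rule fps_ext)
    fix n
    have "(\<Sum>r<K. ?T r) $ m $ n = (\<Sum>r<K. A m n * V m n r)"
      by (simp only: fps_sum_nth term_nth)
    also have "\<dots> = A m n * (\<Sum>r<K. V m n r)"
      by (simp add: sum_distrib_left)
    \<comment> \<open>The terms with \<open>r > m\<close> vanish, so the bound is uniform in \<open>n\<close> and the \<open>x\<close>-adic limit exists.\<close>
    also have "(\<Sum>r<K. V m n r) = (\<Sum>r\<le>m. V m n r)"
      using that by (intro sum.mono_neutral_right) (auto simp: V_def well_poised_term_def pochhammer_of_nat_eq_0_lemma)
    also have "\<dots> = pochhammer c m / pochhammer (c + of_nat n) m"
    proof -
      have "c + of_nat n \<noteq> - of_nat k" for k
        using generic[of "n + k"] unfolding eq_neg_iff_add_eq_0 by (simp add: add.assoc)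
      then show ?thesis
        using well_poised_sum[OF generic, of "- of_nat n" m] by (simp add: V_def)
    qed
    also have "A m n * \<dots> = ?F $ m $ n"
      using nz[of m] pochhammer_product'[of c n m]
      by (simp add: A_def fps2_of_coeffs_def ac_simps)
    finally show "(\<Sum>r<K. ?T r) $ m $ n = ?F $ m $ n" .
  qed
  show ?thesis
    unfolding sums_def
  proof (rule tendsto_fpsI)
    fix m
    show "\<forall>\<^sub>F K in sequentially. (\<Sum>r<K. ?T r) $ m = ?F $ m"
      using eventually_gt_at_top[of m] by eventually_elim (rule sum_nth)
  qed
qed

end
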